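(* Let $\mathbf{k}$ be a field and $\Pi$ a finite poset. If $I^{k+1},\eta^k$ is the output of the algorithm "Step in the minimal injective resolution" (described in the context), then for all $\sigma\in\Pi$, all maximal vectors in $I^{k+1}(\sigma)$ are in the image of $\eta^k(\sigma)$.
   Context: A sheaf $F$ on a finite poset $\Pi$ assigns to each $\pi\in\Pi$ a finite-dimensional $\mathbf{k}$-vector space $F(\pi)$ and to each relation $\tau\le\gamma$ a linear map $F(\tau\le\gamma)$, functorially; natural transformations are collections of linear maps commuting with the sheaf maps. A vector $s\in F(\pi)$ is maximal if $F(\pi\le\tau)(s)=0$ for each $\tau>\pi$. For $\pi\in\Pi$, the sheaf $[\pi]$ has $[\pi](\gamma)=\mathbf{k}$ if $\gamma\le\pi$ and $0$ otherwise, with identity maps $[\pi](\gamma\le\tau)$ when $\gamma\le\tau\le\pi$ and zero maps otherwise. Injective sheaves are, up to isomorphism, the finite direct sums of sheaves $[\pi]$. Write $\mathrm{St}\,\sigma=\{\tau\in\Pi:\sigma\le\tau\}$. Representation. An injective sheaf $I=\bigoplus_{i=1}^l[\pi_i]$ is represented by the tuple $(\pi_1,\dots,\pi_l)$ of its generators (repetitions allowed). A natural transformation $\eta:I\to J$ between injective sheaves is represented by one matrix with columns labeled by the generators of $I$ and rows labeled by the generators of $J$; the entry in a row labeled $\sigma$ and a column labeled $\pi$ is the scalar giving the component $[\pi]\to[\sigma]$, and is $0$ unless $\sigma\le\pi$. For $\sigma\in\Pi$, the linear map $\eta(\sigma)$ is given by the submatrix $\eta[\mathrm{St}\,\sigma,\mathrm{St}\,\sigma]$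 of the rows and columns labeled by elements of $\mathrm{St}\,\sigma$. Conversely every such matrix defines a natural transformation. Algorithm ("Step in the minimal injective resolution"). Input: an injective sheaf $I^k$ and a natural transformation $\eta^{k-1}:I^{k-1}\to I^k$ with $I^{k-1}$ injective, where $I^{k-1}$ and $I^k$ are represented by their tuples of generators and $\eta^{k-1}$ is represented by the matrix with columns labeled by the generators of $I^{k-1}$ and rows labeled by the generators of $I^k$, whose entry in a row labeled $\sigma$ and a column labeled $\pi$ is the scalar giving the component $[\pi]\to[\sigma]$. (For $k=0$ one may take $I^{-1}=F$ an arbitrary sheaf and $\eta^{-1}=\alpha:F\to I^0$, given by the matrices $\alpha(\sigma)$, $\sigma\in\Pi$, with rows labeled by the generators of $I^0$ in $\mathrm{St}\,\sigma$.) Fix a total order $(\sigma_1,\dots,\sigma_n)$ of the elements of $\Pi$ extending its partial order. Start with $I^{k+1}$ empty and $\eta^k$ an empty matrix (no rows, columns labeled by the generators of $I^k$). For $\sigma=\sigma_n,\sigma_{n-1},\dots,\sigma_1$ in this order: let $B$ be a basis of $(\operatorname{im}\eta^{k-1}(\sigma))^\perp=\{v\in\mathbf{k}^{\dim I^k(\sigma)}: v\cdot u=0\ \text{for all } u\in\operatorname{im}\eta^{k-1}(\sigma)\}$; for each $b\in B$ in turn, if $b$ is linearly independent from the current rows of $\eta^k(\sigma)$, append $\sigma$ to the tuple $I^{k+1}$ and add $b$ as the next row of $\eta^k$, labeled by $\sigma$, with entries $0$ in the columns labeled by $\Pi\setminus\mathrm{St}\,\sigma$. Output: $I^{k+1},\eta^k$.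 *)

theory Defs
  imports
    "Jordan_Normal_Form.VS_Connect"
    "Jordan_Normal_Form.DL_Submatrix"
begin

section \<open>Sheaves on a finite poset\<close>

text \<open>The poset is a type of class \<open>{finite, order}\<close>.  The stalk at \<open>\<pi>\<close> is the coordinate space
  \<open>carrier_vec (stalk_dim F \<pi>)\<close>, and the map of a relation \<open>\<sigma> \<le> \<tau>\<close> is given by its matrix
  \<open>sheaf_map F \<sigma> \<tau>\<close>; the values for \<open>\<not> \<sigma> \<le> \<tau>\<close> are irrelevant.\<close>

record ('p, 'k) sheaf =
  stalk_dim :: "'p \<Rightarrow> nat"
  sheaf_map :: "'p \<Rightarrow> 'p \<Rightarrow> 'k mat"

definition is_sheaf :: "('p::{finite,order}, 'k::field) sheaf \<Rightarrow> bool" where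
  "is_sheaf F \<longleftrightarrow>
    (\<forall>\<sigma> \<tau>. \<sigma> \<le> \<tau> \<longrightarrow> sheaf_map F \<sigma> \<tau> \<in> carrier_mat (stalk_dim F \<tau>) (stalk_dim F \<sigma>)) \<and>
    (\<forall>\<sigma>. sheaf_map F \<sigma> \<sigma> = 1\<^sub>m (stalk_dim F \<sigma>)) \<and>
    (\<forall>\<sigma> \<tau> \<gamma>. \<sigma> \<le> \<tau> \<longrightarrow> \<tau> \<le> \<gamma> \<longrightarrow> sheaf_map F \<sigma> \<gamma> = sheaf_map F \<tau> \<gamma> * sheaf_map F \<sigma> \<tau>)"

definition nat_trans ::
  "('p::{finite,order}, 'k::field) sheaf \<Rightarrow> ('p, 'k) sheaf \<Rightarrow> ('p \<Rightarrow> 'k mat) \<Rightarrow> bool" where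
  "nat_trans F G \<eta> \<longleftrightarrow>
    (\<forall>\<sigma>. \<eta> \<sigma> \<in> carrier_mat (stalk_dim G \<sigma>) (stalk_dim F \<sigma>)) \<and>
    (\<forall>\<sigma> \<tau>. \<sigma> \<le> \<tau> \<longrightarrow> sheaf_map G \<sigma> \<tau> * \<eta> \<sigma> = \<eta> \<tau> * sheaf_map F \<sigma> \<tau>)"

definition maximal_vector ::
  "('p::{finite,order}, 'k::field) sheaf \<Rightarrow> 'p \<Rightarrow> 'k vec \<Rightarrow> bool" where
  "maximal_vector F \<pi> s \<longleftrightarrow>
    s \<in> carrier_vec (stalk_dim F \<pi>) \<and>
    (\<forall>\<tau>>\<pi>. sheaf_map F \<pi> \<tau> *\<^sub>v s = 0\<^sub>v (stalk_dim F \<tau>))"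

definition mat_image :: "'k::field mat \<Rightarrow> 'k vec set" where
  "mat_image A = (\<lambda>v. A *\<^sub>v v) ` carrier_vec (dim_col A)"

definition star :: "'p::order \<Rightarrow> 'p set" where
  "star \<sigma> = {\<tau>. \<sigma> \<le> \<tau>}"


section \<open>Injective sheaves and the matrices between them\<close>

definition elementary_sheaf :: "'p::{finite,order} \<Rightarrow> ('p, 'k::field) sheaf" where
  "elementary_sheaf \<pi> =
    \<lparr>stalk_dim = (\<lambda>\<gamma>. if \<gamma> \<le> \<pi> then 1 else 0),
     sheaf_map = (\<lambda>\<gamma> \<tau>. if \<gamma> \<le> \<tau> \<and> \<tau> \<le> \<pi> then 1\<^sub>m 1
                        else 0\<^sub>m (if \<tau> \<le> \<pi> then 1 else 0) (if \<gamma> \<le> \<pi> then 1 else 0))\<rparr>"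

definition direct_sum :: "('p::{finite,order}, 'k::field) sheaf list \<Rightarrow> ('p, 'k) sheaf" where
  "direct_sum Fs =
    \<lparr>stalk_dim = (\<lambda>\<sigma>. \<Sum>F\<leftarrow>Fs. stalk_dim F \<sigma>),
     sheaf_map = (\<lambda>\<sigma> \<tau>. diag_block_mat (map (\<lambda>F. sheaf_map F \<sigma> \<tau>) Fs))\<rparr>"

definition inj_sheaf :: "'p::{finite,order} list \<Rightarrow> ('p, 'k::field) sheaf" where
  "inj_sheaf gs = direct_sum (map elementary_sheaf gs)"

text \<open>Rows and columns are addressed by positions in the tuple of generators, since a generator
  may be repeated.  The coordinates of \<open>inj_sheaf gs\<close> at \<open>\<sigma>\<close> are indexed by
  \<open>star_positions gs \<sigma>\<close>, in increasing order.\<close>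

definition star_positions :: "'p::order list \<Rightarrow> 'p \<Rightarrow> nat set" where
  "star_positions gs \<sigma> = {i. i < length gs \<and> gs ! i \<in> star \<sigma>}"

definition represents_nat_trans ::
  "'p::{finite,order} list \<Rightarrow> 'p list \<Rightarrow> 'k::field mat \<Rightarrow> bool" where
  "represents_nat_trans I J A \<longleftrightarrow>
    A \<in> carrier_mat (length J) (length I) \<and>
    (\<forall>i<length J. \<forall>j<length I. \<not> J ! i \<le> I ! j \<longrightarrow> A $$ (i, j) = 0)"

definition component ::
  "'p::{finite,order} list \<Rightarrow> 'p list \<Rightarrow> 'k::field mat \<Rightarrow> 'p \<Rightarrow> 'k mat" where
  "component I J A \<sigma> = submatrix A (star_positions J \<sigma>) (star_positions I \<sigma>)"


subsection \<open>Consistency of the encoding\<close>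

text \<open>The coordinates of \<open>inj_sheaf gs\<close> are those selected by \<open>star_positions\<close>
  (\<open>stalk_dim_inj_sheaf\<close>, \<open>sheaf_map_inj_sheaf\<close>), it is a sheaf (\<open>is_sheaf_inj_sheaf\<close>), and every
  representing matrix defines a natural transformation (\<open>nat_trans_component\<close>).\<close>

lemma pick_positions:
  assumes "i < card (star_positions gs \<sigma>)"
  shows "pick (star_positions gs \<sigma>) i \<in> star_positions gs \<sigma>"
  using assms by (intro pick_in_set_le)

lemma finite_star_positions [simp]: "finite (star_positions gs \<sigma>)"
  by (simp add: star_positions_def)

lemma star_positions_less: "{i. i < length gs \<and> i \<in> star_positions gs \<sigma>} = star_positions gs \<sigma>"
  by (auto simp: star_positions_def)

lemma star_positions_snoc:
  "star_positions (gs @ [\<pi>]) \<sigma> =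
    (if \<sigma> \<le> \<pi> then insert (length gs) (star_positions gs \<sigma>) else star_positions gs \<sigma>)"
  by (auto simp: star_positions_def star_def nth_append less_Suc_eq)

lemma pick_star_positions_snoc:
  assumes "i < card (star_positions gs \<sigma>)"
  shows "pick (star_positions (gs @ [\<pi>]) \<sigma>) i = pick (star_positions gs \<sigma>) i"
proof -
  let ?S = "star_positions gs \<sigma>" and ?T = "star_positions (gs @ [\<pi>]) \<sigma>"
  have in_S: "pick ?S i \<in> ?S" by (rule pick_positions[OF assms])
  then have lt: "pick ?S i < length gs" by (simp add: star_positions_def)
  have "{a \<in> ?T. a < pick ?S i} = {a \<in> ?S. a < pick ?S i}"
    using lt by (auto simp: star_positions_snoc split: if_splits)
  then have "card {a \<in> ?T. a < pick ?S i} = i" using card_pick_le[OF assms] by simp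
  moreover have "pick ?S i \<in> ?T" using in_S by (auto simp: star_positions_snoc)
  ultimately show ?thesis using pick_card_in_set by metis
qed

lemma pick_star_positions_last:
  assumes "\<sigma> \<le> \<pi>"
  shows "pick (star_positions (gs @ [\<pi>]) \<sigma>) (card (star_positions gs \<sigma>)) = length gs"
proof -
  have "{a \<in> star_positions (gs @ [\<pi>]) \<sigma>. a < length gs} = star_positions gs \<sigma>"
    by (auto simp: star_positions_snoc) (auto simp: star_positions_def)
  moreover have "length gs \<in> star_positions (gs @ [\<pi>]) \<sigma>" using assms by (simp add: star_positions_snoc)
  ultimately show ?thesis using pick_card_in_set by metis
qed

lemma stalk_dim_inj_sheaf:
  "stalk_dim (inj_sheaf gs) \<sigma> = card (star_positions gs \<sigma>)"
proof (induction gs rule: rev_induct)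
  case Nil then show ?case by (simp add: inj_sheaf_def direct_sum_def star_positions_def)
next
  case (snoc \<pi> gs)
  have "length gs \<notin> star_positions gs \<sigma>" by (simp add: star_positions_def)
  with snoc show ?case
    by (auto simp: inj_sheaf_def direct_sum_def elementary_sheaf_def star_positions_snoc)
qed

lemma sheaf_map_inj_sheaf:
  assumes "\<sigma> \<le> \<tau>"
  shows "sheaf_map (inj_sheaf gs :: ('p::{finite,order},'k::field) sheaf) \<sigma> \<tau> =
    submatrix (1\<^sub>m (length gs)) (star_positions gs \<tau>) (star_positions gs \<sigma>)"
proof (induction gs rule: rev_induct)
  case Nil then show ?case
    by (auto intro!: eq_matI simp: inj_sheaf_def direct_sum_def star_positions_def submatrix_def)
next
  case (snoc \<pi> gs)
  let ?n = "length gs"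
  let ?S = "star_positions gs \<sigma>" and ?T = "star_positions gs \<tau>"
  let ?E = "sheaf_map (elementary_sheaf \<pi> :: ('p,'k) sheaf) \<sigma> \<tau>"
  let ?S' = "star_positions (gs @ [\<pi>]) \<sigma>" and ?T' = "star_positions (gs @ [\<pi>]) \<tau>"
  let ?D = "submatrix (1\<^sub>m (length gs)) ?T ?S :: 'k mat"
  have n: "?n \<notin> ?S" "?n \<notin> ?T" by (auto simp: star_positions_def)
  have dims: "dim_row ?D = card ?T" "dim_col ?D = card ?S"
    by (simp_all add: dim_submatrix star_positions_less)
  have E: "?E = (if \<tau> \<le> \<pi> then 1\<^sub>m 1 else 0\<^sub>m 0 (if \<sigma> \<le> \<pi> then 1 else 0))"
    using assms by (simp add: elementary_sheaf_def)
  have cS: "card ?S' = card ?S + (if \<sigma> \<le> \<pi> then 1 else 0)"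
    and cT: "card ?T' = card ?T + (if \<tau> \<le> \<pi> then 1 else 0)"
    using n by (simp_all add: star_positions_snoc)
  have eq: "sheaf_map (inj_sheaf (gs @ [\<pi>]) :: ('p,'k) sheaf) \<sigma> \<tau> =
     four_block_mat ?D (0\<^sub>m (card ?T) (dim_col ?E)) (0\<^sub>m (dim_row ?E) (card ?S)) ?E"
    using snoc dims by (simp add: inj_sheaf_def direct_sum_def diag_block_mat_last Let_def comp_def)
  have less: "\<And>i gs' \<rho>. i < card (star_positions gs' \<rho>) \<Longrightarrow> pick (star_positions gs' \<rho>) i < length gs'"
    using pick_positions by (fastforce simp: star_positions_def)
  show ?case unfolding eq
  proof (rule eq_matI, goal_cases)
    case (1 i j)
    from 1 have i: "i < card ?T'" and j: "j < card ?S'" 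
      by (auto simp: dim_submatrix star_positions_less[of "gs @ [\<pi>]", simplified])
    have lt: "pick ?T' i < Suc ?n" "pick ?S' j < Suc ?n"
      using less[OF i] less[OF j] by auto
    have R: "submatrix (1\<^sub>m (length (gs @ [\<pi>]))) ?T' ?S' $$ (i,j) = (if pick ?T' i = pick ?S' j then 1 else 0 :: 'k)"
      using i j lt by (subst submatrix_index) (auto simp: star_positions_less[of "gs @ [\<pi>]", simplified])
    have D: "i < card ?T \<Longrightarrow> j < card ?S \<Longrightarrow> ?D $$ (i,j) = (if pick ?T i = pick ?S j then 1 else 0 :: 'k)"
      using less[of i gs \<tau>] less[of j gs \<sigma>] by (subst submatrix_index) (auto simp: star_positions_less)
    consider "i < card ?T" "j < card ?S" | "i < card ?T" "j = card ?S" "\<sigma> \<le> \<pi>" | "i = card ?T" "\<tau> \<le> \<pi>" "j < card ?S"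
      | "i = card ?T" "\<tau> \<le> \<pi>" "j = card ?S" "\<sigma> \<le> \<pi>"
      using i j cS cT by (auto simp: less_Suc_eq split: if_splits)
    then show ?case
    proof cases
      case 1
      then show ?thesis unfolding R using dims E D i j cS cT
        by (simp add: pick_star_positions_snoc)
    next
      case 2
      then show ?thesis unfolding R using dims E i j cS cT less[of i gs \<tau>]
        by (auto simp: pick_star_positions_snoc pick_star_positions_last)
    next
      case 3
      then show ?thesis unfolding R using dims E i j cS cT less[of j gs \<sigma>] assms
        by (auto simp: pick_star_positions_snoc pick_star_positions_last)
    next
      case 4
      then show ?thesis unfolding R using dims E i j cS cT
        by (auto simp: pick_star_positions_snoc pick_star_positions_last)
    qed
  qed (use dims E cS cT assms order_trans[OF assms, of \<pi>] in \<open>auto simp: dim_submatrix star_positions_less[of "gs @ [\<pi>]", simplified]\<close>)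
qed

lemma submatrix_mult:
  fixes A B :: "'k::comm_ring_1 mat"
  assumes A: "A \<in> carrier_mat m n" and B: "B \<in> carrier_mat n r"
    and P: "P \<subseteq> {..<m}" and Q: "Q \<subseteq> {..<n}" and R: "R \<subseteq> {..<r}"
    and zero: "\<And>i l k. i \<in> P \<Longrightarrow> k \<in> R \<Longrightarrow> l < n \<Longrightarrow> l \<notin> Q \<Longrightarrow> A $$ (i, l) * B $$ (l, k) = 0"
  shows "submatrix A P Q * submatrix B Q R = submatrix (A * B) P R"
proof -
  have eqs: "{i. i < m \<and> i \<in> P} = P" "{i. i < n \<and> i \<in> Q} = Q" "{i. i < r \<and> i \<in> R} = R"
    using P Q R by auto
  note [simp] = carrier_matD[OF A] carrier_matD[OF B] dim_submatrix eqs
  have bij: "bij_betw (pick Q) {0..<card Q} Q"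
  proof (rule bij_betwI')
    fix x y assume "x \<in> {0..<card Q}" "y \<in> {0..<card Q}"
    then show "(pick Q x = pick Q y) = (x = y)"
      using pick_mono_le[of x Q y] pick_mono_le[of y Q x] by (cases x y rule: linorder_cases) auto
  next
    fix x assume "x \<in> {0..<card Q}" then show "pick Q x \<in> Q" by (simp add: pick_in_set_le)
  next
    fix y assume y: "y \<in> Q"
    have "finite Q" using Q finite_subset by blast
    then have "card {a \<in> Q. a < y} < card Q" using y by (intro psubset_card_mono) auto
    then show "\<exists>x\<in>{0..<card Q}. y = pick Q x" using pick_card_in_set[OF y] by force
  qed
  show ?thesis
  proof (rule eq_matI)
    fix i k assume "i < dim_row (submatrix (A * B) P R)" "k < dim_col (submatrix (A * B) P R)"
    then have i: "i < card P" and k: "k < card R" by simp_all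
    have p: "pick P i \<in> P" "pick R k \<in> R" using i k by (simp_all add: pick_in_set_le)
    then have lt: "pick P i < m" "pick R k < r" using P R by auto
    have "(submatrix A P Q * submatrix B Q R) $$ (i, k) =
        (\<Sum>l\<in>{0..<card Q}. A $$ (pick P i, pick Q l) * B $$ (pick Q l, pick R k))"
      using i k by (simp add: scalar_prod_def submatrix_index)
    also have "\<dots> = (\<Sum>l\<in>Q. A $$ (pick P i, l) * B $$ (l, pick R k))"
      by (rule sum.reindex_bij_betw[OF bij])
    also have "\<dots> = (\<Sum>l\<in>{0..<n}. A $$ (pick P i, l) * B $$ (l, pick R k))"
      using Q p zero by (intro sum.mono_neutral_left) auto
    also have "\<dots> = submatrix (A * B) P R $$ (i, k)"
      using i k lt by (simp add: scalar_prod_def submatrix_index)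
    finally show "(submatrix A P Q * submatrix B Q R) $$ (i, k) = submatrix (A * B) P R $$ (i, k)" .
  qed simp_all
qed

lemma star_positions_subset: "star_positions gs \<sigma> \<subseteq> {..<length gs}"
  by (auto simp: star_positions_def)

lemma star_positions_lessD: "i \<in> star_positions gs \<sigma> \<Longrightarrow> i < length gs"
  by (simp add: star_positions_def)

lemma one_mat_zero:
  "i \<in> star_positions gs \<tau> \<Longrightarrow> star_positions gs \<tau> \<subseteq> star_positions gs \<sigma> \<Longrightarrow>
    l < length gs \<Longrightarrow> l \<notin> star_positions gs \<sigma> \<Longrightarrow> 1\<^sub>m (length gs) $$ (i, l) = 0"
  using star_positions_lessD[of i gs \<tau>] by auto

lemma star_positions_antimono: "\<sigma> \<le> \<tau> \<Longrightarrow> star_positions gs \<tau> \<subseteq> star_positions gs \<sigma>"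
  by (auto simp: star_positions_def star_def)

lemma is_sheaf_inj_sheaf: "is_sheaf (inj_sheaf gs :: ('p::{finite,order}, 'k::field) sheaf)"
  unfolding is_sheaf_def
proof (intro conjI allI impI)
  fix \<sigma> \<tau> :: 'p assume "\<sigma> \<le> \<tau>"
  then show "sheaf_map (inj_sheaf gs :: ('p, 'k) sheaf) \<sigma> \<tau> \<in>
      carrier_mat (stalk_dim (inj_sheaf gs :: ('p, 'k) sheaf) \<tau>) (stalk_dim (inj_sheaf gs :: ('p, 'k) sheaf) \<sigma>)"
    by (auto simp: sheaf_map_inj_sheaf stalk_dim_inj_sheaf dim_submatrix star_positions_less)
next
  fix \<sigma> :: 'p
  let ?S = "star_positions gs \<sigma>"
  have "pick ?S i < length gs" if "i < card ?S" for i
    using pick_positions[OF that] by (auto simp: star_positions_def)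
  moreover have "(pick ?S i = pick ?S j) = (i = j)" if "i < card ?S" "j < card ?S" for i j
    using that card_pick_le by metis
  ultimately show "sheaf_map (inj_sheaf gs :: ('p, 'k) sheaf) \<sigma> \<sigma> = 1\<^sub>m (stalk_dim (inj_sheaf gs :: ('p, 'k) sheaf) \<sigma>)"
    by (auto intro!: eq_matI simp: sheaf_map_inj_sheaf stalk_dim_inj_sheaf submatrix_index dim_submatrix
        star_positions_less)
next
  fix \<sigma> \<tau> \<gamma> :: 'p assume le: "\<sigma> \<le> \<tau>" "\<tau> \<le> \<gamma>"
  have "submatrix (1\<^sub>m (length gs)) (star_positions gs \<gamma>) (star_positions gs \<tau>) *
      submatrix (1\<^sub>m (length gs)) (star_positions gs \<tau>) (star_positions gs \<sigma>) =
      submatrix (1\<^sub>m (length gs) * 1\<^sub>m (length gs) :: 'k mat) (star_positions gs \<gamma>) (star_positions gs \<sigma>)"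
    using star_positions_antimono[OF le(2), of gs]
    by (intro submatrix_mult[where m = "length gs" and n = "length gs" and r = "length gs"])
      (auto simp: star_positions_lessD intro: one_mat_zero)
  with le show "sheaf_map (inj_sheaf gs :: ('p, 'k) sheaf) \<sigma> \<gamma> =
      sheaf_map (inj_sheaf gs) \<tau> \<gamma> * sheaf_map (inj_sheaf gs) \<sigma> \<tau>"
    using order_trans[OF le] by (simp add: sheaf_map_inj_sheaf)
qed

lemma nat_trans_component:
  fixes A :: "'k::field mat" and I J :: "'p::{finite,order} list"
  assumes "represents_nat_trans I J A"
  shows "nat_trans (inj_sheaf I) (inj_sheaf J) (component I J A)"
  unfolding nat_trans_def
proof (intro conjI allI impI)
  have A: "A \<in> carrier_mat (length J) (length I)"
    and A0: "\<And>i j. i < length J \<Longrightarrow> j < length I \<Longrightarrow> \<not> J ! i \<le> I ! j \<Longrightarrow> A $$ (i, j) = 0"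
    using assms by (auto simp: represents_nat_trans_def)
  note [simp] = carrier_matD[OF A]
  show "component I J A \<sigma> \<in>
      carrier_mat (stalk_dim (inj_sheaf J :: ('p, 'k) sheaf) \<sigma>) (stalk_dim (inj_sheaf I :: ('p, 'k) sheaf) \<sigma>)" for \<sigma>
    by (auto simp: component_def stalk_dim_inj_sheaf dim_submatrix star_positions_less)
  fix \<sigma> \<tau> :: 'p assume le: "\<sigma> \<le> \<tau>"
  have "submatrix (1\<^sub>m (length J)) (star_positions J \<tau>) (star_positions J \<sigma>) * component I J A \<sigma> =
      submatrix (1\<^sub>m (length J) * A) (star_positions J \<tau>) (star_positions I \<sigma>)"
    unfolding component_def using A star_positions_antimono[OF le, of J]
    by (intro submatrix_mult[where m = "length J" and n = "length J" and r = "length I"])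
      (auto simp: star_positions_lessD intro: one_mat_zero)
  also have "1\<^sub>m (length J) * A = A * 1\<^sub>m (length I)" using A by simp
  also have "submatrix (A * 1\<^sub>m (length I)) (star_positions J \<tau>) (star_positions I \<sigma>) =
      component I J A \<tau> * submatrix (1\<^sub>m (length I)) (star_positions I \<tau>) (star_positions I \<sigma>)"
    unfolding component_def
  proof (rule submatrix_mult[symmetric, OF A _ star_positions_subset star_positions_subset star_positions_subset])
    fix i l k assume "i \<in> star_positions J \<tau>" "l < length I" "l \<notin> star_positions I \<tau>"
    then have "A $$ (i, l) = 0" by (intro A0) (auto simp: star_positions_def star_def)
    then show "A $$ (i, l) * 1\<^sub>m (length I) $$ (l, k) = 0" by simp
  qed simp
  finally show "sheaf_map (inj_sheaf J) \<sigma> \<tau> * component I J A \<sigma> = component I J A \<tau> * sheaf_map (inj_sheaf I) \<sigma> \<tau>"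
    using le by (simp add: sheaf_map_inj_sheaf)
qed


section \<open>Step in the minimal injective resolution\<close>

text \<open>\<open>step_input I \<eta>\<close>: the maps \<open>\<eta> \<sigma>\<close> constitute an admissible \<open>\<eta>\<^sup>k\<^sup>-\<^sup>1\<close> into \<open>I\<^sup>k = inj_sheaf I\<close>.
  It either comes from an injective sheaf, represented by a matrix, or (for \<open>k = 0\<close>) it is a
  natural transformation from an arbitrary sheaf.\<close>

inductive step_input :: "'p::{finite,order} list \<Rightarrow> ('p \<Rightarrow> 'k::field mat) \<Rightarrow> bool"
  for I :: "'p list" where
  injective: "represents_nat_trans I' I A \<Longrightarrow> step_input I (component I' I A)"
| initial: "is_sheaf F \<Longrightarrow> nat_trans F (inj_sheaf I) \<alpha> \<Longrightarrow> step_input I \<alpha>"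

definition is_basis_list :: "nat \<Rightarrow> 'k::field vec set \<Rightarrow> 'k vec list \<Rightarrow> bool" where
  "is_basis_list n W bs \<longleftrightarrow>
    distinct bs \<and> vectorspace.basis class_ring ((module_vec TYPE('k) n)\<lparr>carrier := W\<rparr>) (set bs)"

text \<open>Pad a vector indexed by \<open>star_positions I \<sigma>\<close> with zeros to a row indexed by all of \<open>I\<close>.\<close>

definition extend_row :: "'p::order list \<Rightarrow> 'p \<Rightarrow> 'k::zero vec \<Rightarrow> 'k vec" where
  "extend_row I \<sigma> b =
    vec (length I) (\<lambda>j. if j \<in> star_positions I \<sigma>
                        then b $ card {i \<in> star_positions I \<sigma>. i < j} else 0)"

text \<open>The state consists of the current tuple \<open>I\<^sup>k\<^sup>+\<^sup>1\<close> and the current matrix \<open>\<eta>\<^sup>k\<close>.\<close>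

fun process_vector ::
  "'p::{finite,order} list \<Rightarrow> 'p \<Rightarrow> 'k::field vec \<Rightarrow> 'p list \<times> 'k mat \<Rightarrow> 'p list \<times> 'k mat" where
  "process_vector I \<sigma> b (J, A) =
    (if b \<in> LinearCombinations.module.span class_ring
              (module_vec TYPE('k) (card (star_positions I \<sigma>)))
              (set (rows (component I J A \<sigma>)))
     then (J, A)
     else (J @ [\<sigma>], A @\<^sub>r mat_of_row (extend_row I \<sigma> b)))"

definition run_step ::
  "'p::{finite,order} list \<Rightarrow> 'p list \<Rightarrow> ('p \<Rightarrow> 'k::field vec list) \<Rightarrow> 'p list \<times> 'k mat" where
  "run_step I \<sigma>s B =
    fold (\<lambda>\<sigma>. fold (process_vector I \<sigma>) (B \<sigma>)) (rev \<sigma>s) ([], 0\<^sub>m 0 (length I))"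

definition linear_extension :: "'p::{finite,order} list \<Rightarrow> bool" where
  "linear_extension \<sigma>s \<longleftrightarrow>
    distinct \<sigma>s \<and> set \<sigma>s = UNIV \<and>
    (\<forall>i<length \<sigma>s. \<forall>j<length \<sigma>s. \<sigma>s ! i \<le> \<sigma>s ! j \<longrightarrow> i \<le> j)"

text \<open>The algorithm leaves open the linear extension and the bases, hence \<open>step_output\<close> is a
  relation.\<close>

definition step_output ::
  "'p::{finite,order} list \<Rightarrow> ('p \<Rightarrow> 'k::field mat) \<Rightarrow> 'p list \<Rightarrow> 'k mat \<Rightarrow> bool" where
  "step_output I \<eta> J A \<longleftrightarrow>
    (\<exists>\<sigma>s B. linear_extension \<sigma>s \<and>
      (\<forall>\<sigma>. is_basis_list (stalk_dim (inj_sheaf I :: ('p, 'k) sheaf) \<sigma>)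
             (vec_module.orthogonal_complement (stalk_dim (inj_sheaf I :: ('p, 'k) sheaf) \<sigma>)
               (mat_image (\<eta> \<sigma>)))
             (B \<sigma>)) \<and>
      (J, A) = run_step I \<sigma>s B)"

end

theory Submission
  imports Defs
begin

text \<open>
  A maximal vector of an injective sheaf at \<open>\<sigma>\<close> is one whose coordinates at generators
  strictly above \<open>\<sigma>\<close> vanish, so the theorem asks that the rows of \<open>\<eta>\<^sup>k(\<sigma>)\<close> labeled \<open>\<sigma>\<close> can
  be given arbitrary values by a vector that all the rows labeled above \<open>\<sigma>\<close> annihilate.

  These rows are created one at a time, and each is outside the span of the rows present at that
  moment, among which are all rows labeled strictly above \<open>\<sigma>\<close>.  A vector \<open>b\<close> outside a span is
  detected by some \<open>x\<close> that is orthogonal to the span with \<open>b \<bullet> x \<noteq> 0\<close> (\<open>in_span_of_annihilator\<close>).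
  Adding a multiple of \<open>x\<close> to a solution for the old rows solves the new row as well and spoils
  none of the old ones; this is the induction step (\<open>solves_own_process_same\<close>).  Before the
  pass for \<open>\<sigma>\<close> there is nothing to solve, and after it no row is added whose label lies in the star
  of \<open>\<sigma>\<close>, because the labels are processed against a linear extension.
\<close>

section \<open>Spans and annihilators\<close>

text \<open>A finite-dimensional double annihilator theorem, valid over every field: the dot product may
  have isotropic vectors, so orthogonal projection is unavailable.  Instead one eliminates a
  generator \<open>r\<close>: if some \<open>y\<close> annihilates the other generators but not \<open>r\<close>, the multiple of \<open>r\<close> with
  the same value at \<open>y\<close> is subtracted from \<open>b\<close>; otherwise \<open>r\<close> imposes no further condition.\<close>

lemma in_span_of_annihilator:
  fixes b :: "'k::field vec"
  assumes "set rs \<subseteq> carrier_vec n" and "b \<in> carrier_vec n"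
    and "\<And>x. x \<in> carrier_vec n \<Longrightarrow> (\<And>r. r \<in> set rs \<Longrightarrow> r \<bullet> x = 0) \<Longrightarrow> b \<bullet> x = 0"
  shows "b \<in> LinearCombinations.module.span class_ring (module_vec TYPE('k) n) (set rs)"
proof -
  interpret vec_space "TYPE('k)" n .
  show ?thesis using assms
  proof (induction rs arbitrary: b)
    case Nil
    have "b $ i = 0" if "i < n" for i
      using Nil(3)[of "unit_vec n i"] Nil(2) that by simp
    then have "b = 0\<^sub>v n" using Nil(2) by (intro eq_vecI) auto
    then show ?case by (simp add: span_empty)
  next
    case (Cons r rs)
    have rs: "set rs \<subseteq> carrier_vec n" and r: "r \<in> carrier_vec n" and b: "b \<in> carrier_vec n"
      using Cons.prems by auto
    have mono: "span (set rs) \<subseteq> span (set (r # rs))" by (rule span_is_monotone) auto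
    show ?case
    proof (cases "\<exists>y\<in>carrier_vec n. (\<forall>r'\<in>set rs. r' \<bullet> y = 0) \<and> r \<bullet> y \<noteq> 0")
      case True
      then obtain y where y: "y \<in> carrier_vec n" and y0: "\<And>r'. r' \<in> set rs \<Longrightarrow> r' \<bullet> y = 0"
        and ry: "r \<bullet> y \<noteq> 0" by auto
      define c where "c = (b \<bullet> y) / (r \<bullet> y)"
      define b' where "b' = b + (- c) \<cdot>\<^sub>v r"
      have b': "b' \<in> carrier_vec n" using b r by (simp add: b'_def)
      have "b' \<in> span (set rs)"
      proof (rule Cons.IH[OF rs b'])
        fix x assume x: "x \<in> carrier_vec n" and x0: "\<And>r'. r' \<in> set rs \<Longrightarrow> r' \<bullet> x = 0"
        define d where "d = (r \<bullet> x) / (r \<bullet> y)"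
        have dot: "u \<bullet> (x + (- d) \<cdot>\<^sub>v y) = u \<bullet> x - d * (u \<bullet> y)" if "u \<in> carrier_vec n" for u
          using that x y by (simp add: scalar_prod_add_distrib)
        have "b \<bullet> (x + (- d) \<cdot>\<^sub>v y) = 0"
        proof (rule Cons.prems(3))
          fix r' assume "r' \<in> set (r # rs)"
          then have "r' \<in> carrier_vec n" and "r' \<bullet> x = d * (r' \<bullet> y)"
            using rs r x0 y0 ry by (auto simp: d_def)
          then show "r' \<bullet> (x + (- d) \<cdot>\<^sub>v y) = 0" by (simp add: dot)
        qed (use x y in simp)
        then have "b \<bullet> x = d * (b \<bullet> y)" by (simp add: dot b)
        moreover have "b' \<bullet> x = b \<bullet> x - c * (r \<bullet> x)"
          using b r x by (simp add: b'_def add_scalar_prod_distrib)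
        ultimately show "b' \<bullet> x = 0" by (simp add: c_def d_def)
      qed
      moreover have "r \<in> span (set (r # rs))"
        using in_own_span[of "set (r # rs)"] rs r by auto
      then have "c \<cdot>\<^sub>v r \<in> span (set (r # rs))"
        using rs r by (intro smult_in_span) auto
      ultimately have "b' + c \<cdot>\<^sub>v r \<in> span (set (r # rs))"
        using mono rs r span_add1[of "set (r # rs)" b' "c \<cdot>\<^sub>v r"] by auto
      moreover have "b' + c \<cdot>\<^sub>v r = b"
        using b r by (intro eq_vecI) (auto simp: b'_def)
      ultimately show ?thesis by simp
    next
      case False
      then have "b \<in> span (set rs)"
        by (intro Cons.IH[OF rs b] Cons.prems(3)) auto
      then show ?thesis using mono by auto
    qed
  qed
qed

text \<open>The basis predicate unfolds only over a vector space, so that the orthogonal complement has to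
  be recognised as a subspace, even to learn that a basis of it consists of its elements.\<close>

lemma basis_list_orthogonal_complement_carrier:
  fixes S :: "'k::field vec set"
  assumes "is_basis_list n (vec_module.orthogonal_complement n S) bs" and "S \<subseteq> carrier_vec n"
  shows "set bs \<subseteq> carrier_vec n"
proof -
  interpret vec_space "TYPE('k)" n .
  let ?W = "orthogonal_complement S"
  have "VectorSpace.subspace class_ring ?W V"
    unfolding VectorSpace.subspace_def
  proof
    show "submodule class_ring ?W V"
      using assms(2) module_axioms
      by unfold_locales
        (auto simp: orthogonal_complement_def add_scalar_prod_distrib subset_iff module_vec_simps
          class_ring_simps)
  qed (rule vectorspace_axioms)
  then have "vectorspace class_ring (V\<lparr>carrier := ?W\<rparr>)" by (rule subspace_is_vs)
  then have "set bs \<subseteq> ?W"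
    using assms(1) by (simp add: is_basis_list_def vectorspace.basis_def)
  then show ?thesis by (auto simp: orthogonal_complement_def)
qed

section \<open>Appending a generator\<close>

lemma component_carrier:
  assumes "A \<in> carrier_mat (length J) (length I)"
  shows "component I J A \<sigma> \<in> carrier_mat (card (star_positions J \<sigma>)) (card (star_positions I \<sigma>))"
  using assms by (auto simp: component_def dim_submatrix star_positions_less)

lemma component_index:
  assumes "A \<in> carrier_mat (length J) (length I)"
    and "i < card (star_positions J \<sigma>)" "j < card (star_positions I \<sigma>)"
  shows "component I J A \<sigma> $$ (i, j) = A $$ (pick (star_positions J \<sigma>) i, pick (star_positions I \<sigma>) j)"
  using assms by (simp add: component_def submatrix_index star_positions_less)

lemma pick_star_positions_less:
  "i < card (star_positions gs \<sigma>) \<Longrightarrow> pick (star_positions gs \<sigma>) i < length gs"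
  by (rule star_positions_lessD[OF pick_positions])

lemma append_row_index:
  assumes "A \<in> carrier_mat m n" "r \<in> carrier_vec n" "i < Suc m" "j < n"
  shows "(A @\<^sub>r mat_of_row r) $$ (i, j) = (if i < m then A $$ (i, j) else r $ j)"
  using assms by (auto simp: append_rows_def)

lemma append_row_carrier:
  assumes "A \<in> carrier_mat (length J) n" "r \<in> carrier_vec n"
  shows "A @\<^sub>r mat_of_row r \<in> carrier_mat (length (J @ [\<sigma>])) n"
  using assms carrier_append_rows[of A "length J" n "mat_of_row r" 1] by simp

lemma extend_row_carrier [simp]: "extend_row I \<sigma> b \<in> carrier_vec (length I)"
  by (simp add: extend_row_def)

lemma component_snoc_outside:
  assumes A: "A \<in> carrier_mat (length J) (length I)" and r: "r \<in> carrier_vec (length I)"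
    and "\<not> \<sigma> \<le> \<tau>"
  shows "component I (J @ [\<tau>]) (A @\<^sub>r mat_of_row r) \<sigma> = component I J A \<sigma>"
proof -
  note A' = append_row_carrier[OF A r, of \<tau>]
  have star: "star_positions (J @ [\<tau>]) \<sigma> = star_positions J \<sigma>"
    using assms(3) by (simp add: star_positions_snoc)
  note dims = component_carrier[OF A, of \<sigma>] component_carrier[OF A', of \<sigma>, unfolded star]
  show ?thesis
  proof (rule eq_matI)
    fix i j assume "i < dim_row (component I J A \<sigma>)" "j < dim_col (component I J A \<sigma>)"
    then have i: "i < card (star_positions J \<sigma>)" and j: "j < card (star_positions I \<sigma>)"
      using dims by auto
    show "component I (J @ [\<tau>]) (A @\<^sub>r mat_of_row r) \<sigma> $$ (i, j) = component I J A \<sigma> $$ (i, j)"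
      using i j pick_star_positions_less[OF i] pick_star_positions_less[OF j]
      by (simp add: component_index[OF A] component_index[OF A'] star append_row_index[OF A r])
  qed (use dims in auto)
qed

text \<open>Restricting a padded row to the star undoes the padding, so at \<open>\<sigma>\<close> the appended row is \<open>b\<close>.\<close>

lemma component_snoc_same:
  assumes A: "A \<in> carrier_mat (length J) (length I)" and b: "b \<in> carrier_vec (card (star_positions I \<sigma>))"
  shows "component I (J @ [\<sigma>]) (A @\<^sub>r mat_of_row (extend_row I \<sigma> b)) \<sigma> = component I J A \<sigma> @\<^sub>r mat_of_row b"
    (is "component I ?J' ?A' \<sigma> = _")
proof -
  let ?r = "extend_row I \<sigma> b"
  note A' = append_row_carrier[OF A extend_row_carrier[of I \<sigma> b], of \<sigma>]
  note C = component_carrier[OF A, of \<sigma>]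
  have star: "card (star_positions ?J' \<sigma>) = Suc (card (star_positions J \<sigma>))"
    by (simp add: star_positions_snoc) (simp add: star_positions_def)
  have D: "component I ?J' ?A' \<sigma> \<in> carrier_mat (Suc (card (star_positions J \<sigma>))) (card (star_positions I \<sigma>))"
    using component_carrier[OF A', of \<sigma>] by (simp add: star)
  have E: "component I J A \<sigma> @\<^sub>r mat_of_row b \<in> carrier_mat (Suc (card (star_positions J \<sigma>))) (card (star_positions I \<sigma>))"
    using carrier_append_rows[OF C, of "mat_of_row b" 1] b by simp
  show ?thesis
  proof (rule eq_matI)
    fix i j assume "i < dim_row (component I J A \<sigma> @\<^sub>r mat_of_row b)" "j < dim_col (component I J A \<sigma> @\<^sub>r mat_of_row b)"
    then have i: "i < Suc (card (star_positions J \<sigma>))" and j: "j < card (star_positions I \<sigma>)"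
      using E by auto
    have r: "?r $ pick (star_positions I \<sigma>) j = b $ j"
      using pick_star_positions_less[OF j] pick_positions[OF j] card_pick_le[OF j]
      by (simp add: extend_row_def)
    show "component I ?J' ?A' \<sigma> $$ (i, j) = (component I J A \<sigma> @\<^sub>r mat_of_row b) $$ (i, j)"
    proof (cases "i < card (star_positions J \<sigma>)")
      case True
      then show ?thesis
        using i j pick_star_positions_less[OF True] pick_star_positions_less[OF j]
        by (simp add: component_index[OF A] component_index[OF A'] star append_row_index[OF A extend_row_carrier]
            append_row_index[OF C b] pick_star_positions_snoc)
    next
      case False
      then have "i = card (star_positions J \<sigma>)" using i by simp
      then show ?thesis
        using i j pick_star_positions_less[OF j] r
        by (simp add: component_index[OF A'] star append_row_index[OF A extend_row_carrier]
            append_row_index[OF C b] pick_star_positions_last)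
    qed
  qed (use D E in auto)
qed

section \<open>Solving the rows labeled by a poset element\<close>

text \<open>The own coordinates of \<open>\<sigma>\<close> are those of generators equal to \<open>\<sigma>\<close>; all others in the stalk
  belong to generators strictly above \<open>\<sigma>\<close>.\<close>

definition supported_on_own :: "'p::{finite,order} list \<Rightarrow> 'p \<Rightarrow> 'k::field vec \<Rightarrow> bool" where
  "supported_on_own J \<sigma> s \<longleftrightarrow> s \<in> carrier_vec (card (star_positions J \<sigma>)) \<and>
    (\<forall>i<card (star_positions J \<sigma>). J ! pick (star_positions J \<sigma>) i \<noteq> \<sigma> \<longrightarrow> s $ i = 0)"

text \<open>A coordinate belonging to a generator \<open>\<tau> > \<sigma>\<close> survives the restriction to \<open>\<tau>\<close>, hence it vanishes
  in a maximal vector.\<close>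

lemma maximal_vector_supported_on_own:
  fixes s :: "'k::field vec" and \<sigma> :: "'p::{finite,order}"
  assumes "maximal_vector (inj_sheaf J :: ('p, 'k) sheaf) \<sigma> s"
  shows "supported_on_own J \<sigma> s"
  unfolding supported_on_own_def
proof (intro conjI allI impI)
  let ?S = "star_positions J \<sigma>"
  show s: "s \<in> carrier_vec (card ?S)"
    using assms by (simp add: maximal_vector_def stalk_dim_inj_sheaf)
  fix i assume i: "i < card ?S" and neq: "J ! pick ?S i \<noteq> \<sigma>"
  define \<tau> where "\<tau> = J ! pick ?S i"
  let ?T = "star_positions J \<tau>"
  have "\<sigma> \<le> \<tau>" using pick_positions[OF i] by (simp add: \<tau>_def star_positions_def star_def)
  with neq have less: "\<sigma> < \<tau>" by (simp add: \<tau>_def)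
  let ?R = "submatrix (1\<^sub>m (length J)) ?T ?S :: 'k mat"
  have R0: "?R *\<^sub>v s = 0\<^sub>v (card ?T)"
    using assms less \<open>\<sigma> \<le> \<tau>\<close> by (simp add: maximal_vector_def sheaf_map_inj_sheaf stalk_dim_inj_sheaf)
  have T: "pick ?S i \<in> ?T"
    using pick_positions[OF i] by (simp add: \<tau>_def star_positions_def star_def)
  define i' where "i' = card {a \<in> ?T. a < pick ?S i}"
  have pick: "pick ?T i' = pick ?S i" unfolding i'_def by (rule pick_card_in_set[OF T])
  have i': "i' < card ?T" unfolding i'_def using T by (intro psubset_card_mono) auto
  have dims: "dim_row ?R = card ?T" "dim_col ?R = card ?S"
    by (simp_all add: dim_submatrix star_positions_less)
  have "row ?R i' = unit_vec (card ?S) i"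
  proof (rule eq_vecI)
    fix j assume "j < dim_vec (unit_vec (card ?S) i :: 'k vec)"
    then have j: "j < card ?S" by simp
    have "pick ?S i = pick ?S j \<longleftrightarrow> i = j" using card_pick_le[OF i] card_pick_le[OF j] by metis
    then show "row ?R i' $ j = unit_vec (card ?S) i $ j"
      using i i' j dims pick_star_positions_less[OF i] pick_star_positions_less[OF j]
      by (auto simp: submatrix_index star_positions_less pick)
  qed (simp add: dims)
  then have "s $ i = row ?R i' \<bullet> s" using s i by simp
  also have "\<dots> = (?R *\<^sub>v s) $ i'" using i' dims by simp
  finally show "s $ i = 0" using R0 i' by simp
qed

definition solves_own :: "'p::{finite,order} list \<Rightarrow> 'p \<Rightarrow> 'p list \<times> 'k::field mat \<Rightarrow> bool" where
  "solves_own I \<sigma> = (\<lambda>(J, A). \<forall>s. supported_on_own J \<sigma> s \<longrightarrow>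
     (\<exists>v\<in>carrier_vec (card (star_positions I \<sigma>)). component I J A \<sigma> *\<^sub>v v = s))"

definition well_dimensioned :: "'p::{finite,order} list \<Rightarrow> 'p list \<times> 'k::field mat \<Rightarrow> bool" where
  "well_dimensioned I = (\<lambda>(J, A). A \<in> carrier_mat (length J) (length I))"

lemma well_dimensioned_process:
  "well_dimensioned I st \<Longrightarrow> well_dimensioned I (process_vector I \<tau> b st)"
  using append_row_carrier[OF _ extend_row_carrier]
  by (cases st) (auto simp: well_dimensioned_def)

lemma labels_process: "set (fst (process_vector I \<tau> b st)) \<subseteq> insert \<tau> (set (fst st))"
  by (cases st) auto

lemma solves_own_no_label:
  fixes st :: "'p::{finite,order} list \<times> 'k::field mat"
  assumes "well_dimensioned I st" and "\<sigma> \<notin> set (fst st)"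
  shows "solves_own I \<sigma> st"
proof -
  obtain J A where st: "st = (J, A)" by (cases st)
  have C: "component I J A \<sigma> \<in> carrier_mat (card (star_positions J \<sigma>)) (card (star_positions I \<sigma>))"
    using assms(1) by (intro component_carrier) (simp add: st well_dimensioned_def)
  have "s = 0\<^sub>v (card (star_positions J \<sigma>))" if s: "supported_on_own J \<sigma> s" for s :: "'k vec"
  proof (rule eq_vecI)
    fix i assume "i < dim_vec (0\<^sub>v (card (star_positions J \<sigma>)) :: 'k vec)"
    then have i: "i < card (star_positions J \<sigma>)" by simp
    have "J ! pick (star_positions J \<sigma>) i \<noteq> \<sigma>"
      using nth_mem[OF pick_star_positions_less[OF i]] assms(2) by (auto simp: st)
    with s i show "s $ i = 0\<^sub>v (card (star_positions J \<sigma>)) $ i" by (simp add: supported_on_own_def)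
  qed (use s in \<open>auto simp: supported_on_own_def\<close>)
  moreover have "component I J A \<sigma> *\<^sub>v 0\<^sub>v (card (star_positions I \<sigma>)) = 0\<^sub>v (card (star_positions J \<sigma>))"
    using C by (intro eq_vecI) auto
  ultimately show ?thesis
    unfolding solves_own_def st prod.case by (blast intro: zero_carrier_vec)
qed

lemma solves_own_process_outside:
  assumes "well_dimensioned I st" "solves_own I \<sigma> st" "\<not> \<sigma> \<le> \<tau>"
  shows "solves_own I \<sigma> (process_vector I \<tau> b st)"
proof -
  obtain J A where st: "st = (J, A)" by (cases st)
  have A: "A \<in> carrier_mat (length J) (length I)" using assms(1) by (simp add: st well_dimensioned_def)
  have "star_positions (J @ [\<tau>]) \<sigma> = star_positions J \<sigma>"
    using assms(3) by (simp add: star_positions_snoc)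
  moreover have "(J @ [\<tau>]) ! pick (star_positions J \<sigma>) i = J ! pick (star_positions J \<sigma>) i"
    if "i < card (star_positions J \<sigma>)" for i
    using pick_star_positions_less[OF that] by (simp add: nth_append)
  ultimately have "supported_on_own (J @ [\<tau>]) \<sigma> s \<longleftrightarrow> supported_on_own J \<sigma> s" for s :: "'b vec"
    by (simp add: supported_on_own_def)
  then show ?thesis
    using assms(2) component_snoc_outside[OF A extend_row_carrier assms(3)]
    by (simp add: st solves_own_def)
qed

text \<open>The correction vector \<open>x\<close> lies in the kernel of the old rows, so it can repair the new coordinate
  independently of the others; this is where the independence test of the algorithm is used.\<close>

lemma solves_own_process_same:
  fixes st :: "'p::{finite,order} list \<times> 'k::field mat"
  assumes "well_dimensioned I st" "solves_own I \<sigma> st" and b: "b \<in> carrier_vec (card (star_positions I \<sigma>))"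
  shows "solves_own I \<sigma> (process_vector I \<sigma> b st)"
proof -
  obtain J A where st: "st = (J, A)" by (cases st)
  have A: "A \<in> carrier_mat (length J) (length I)" using assms(1) by (simp add: st well_dimensioned_def)
  let ?n = "card (star_positions I \<sigma>)" and ?m = "card (star_positions J \<sigma>)"
  let ?C = "component I J A \<sigma>"
  let ?J' = "J @ [\<sigma>]"
  have C: "?C \<in> carrier_mat ?m ?n" by (rule component_carrier[OF A])
  show ?thesis
  proof (cases "b \<in> LinearCombinations.module.span class_ring (module_vec TYPE('k) ?n) (set (rows ?C))")
    case True
    then show ?thesis using assms(2) by (simp add: st)
  next
    case False
    have "set (rows ?C) \<subseteq> carrier_vec ?n" using C by (auto simp: rows_def)
    with False b obtain x where x: "x \<in> carrier_vec ?n"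
      and x0: "\<And>r. r \<in> set (rows ?C) \<Longrightarrow> r \<bullet> x = 0" and bx: "b \<bullet> x \<noteq> 0"
      using in_span_of_annihilator by blast
    have Cx: "?C *\<^sub>v x = 0\<^sub>v ?m" using C by (intro eq_vecI) (auto intro!: x0 simp: rows_def)
    have m': "card (star_positions ?J' \<sigma>) = ?m + 1"
      by (simp add: star_positions_snoc) (simp add: star_positions_def)
    have "\<exists>v\<in>carrier_vec ?n. (?C @\<^sub>r mat_of_row b) *\<^sub>v v = s" if "supported_on_own ?J' \<sigma> s" for s
    proof -
      have s: "s \<in> carrier_vec (?m + 1)" using that by (simp add: supported_on_own_def m')
      have "supported_on_own J \<sigma> (vec_first s ?m)"
        unfolding supported_on_own_def
      proof (intro conjI allI impI)
        fix i assume i: "i < ?m" and "J ! pick (star_positions J \<sigma>) i \<noteq> \<sigma>"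
        then have "?J' ! pick (star_positions ?J' \<sigma>) i \<noteq> \<sigma>"
          using pick_star_positions_less[OF i] by (simp add: pick_star_positions_snoc nth_append)
        with that i show "vec_first s ?m $ i = 0"
          by (simp add: supported_on_own_def m' vec_first_def)
      qed simp
      then obtain v where v: "v \<in> carrier_vec ?n" and Cv: "?C *\<^sub>v v = vec_first s ?m"
        using assms(2) by (auto simp: solves_own_def st)
      define c where "c = (s $ ?m - b \<bullet> v) / (b \<bullet> x)"
      have w: "v + c \<cdot>\<^sub>v x \<in> carrier_vec ?n" using v x by simp
      have old: "?C *\<^sub>v (v + c \<cdot>\<^sub>v x) = vec_first s ?m"
        using C v x by (intro eq_vecI)
          (simp_all add: mult_add_distrib_mat_vec[OF C] mult_mat_vec[OF C] Cv Cx)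
      have "b \<bullet> (v + c \<cdot>\<^sub>v x) = s $ ?m"
        using b v x bx by (simp add: scalar_prod_add_distrib c_def)
      then have new: "mat_of_row b *\<^sub>v (v + c \<cdot>\<^sub>v x) = vec_last s 1"
        using s by (intro eq_vecI) (auto simp: vec_last_def)
      have "(?C @\<^sub>r mat_of_row b) *\<^sub>v (v + c \<cdot>\<^sub>v x) = vec_first s ?m @\<^sub>v vec_last s 1"
        using b by (subst mat_mult_append[OF C _ w, of _ 1]) (simp_all add: old new)
      also have "\<dots> = s" using s by (rule vec_first_last_append)
      finally show ?thesis using w by blast
    qed
    with False show ?thesis by (simp add: st solves_own_def component_snoc_same[OF A b])
  qed
qed

section \<open>The passes of the algorithm\<close>

lemma well_dimensioned_pass:
  "well_dimensioned I st \<Longrightarrow> well_dimensioned I (fold (process_vector I \<tau>) bs st)"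
  by (rule fold_invariant[where Q = "\<lambda>_. True"]) (auto intro: well_dimensioned_process)

lemma labels_pass: "set (fst (fold (process_vector I \<tau>) bs st)) \<subseteq> insert \<tau> (set (fst st))"
  by (rule fold_invariant[where Q = "\<lambda>_. True"]) (use labels_process in fastforce)+

lemma passes_no_label:
  assumes "\<sigma> \<notin> set \<tau>s" "well_dimensioned I st" "\<sigma> \<notin> set (fst st)"
  shows "well_dimensioned I (fold (\<lambda>\<tau>. fold (process_vector I \<tau>) (B \<tau>)) \<tau>s st) \<and>
    \<sigma> \<notin> set (fst (fold (\<lambda>\<tau>. fold (process_vector I \<tau>) (B \<tau>)) \<tau>s st))"
  by (rule fold_invariant[where Q = "\<lambda>\<tau>. \<tau> \<noteq> \<sigma>"])
    (use assms labels_pass well_dimensioned_pass in \<open>fastforce\<close>)+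

lemma pass_same:
  assumes "set bs \<subseteq> carrier_vec (card (star_positions I \<sigma>))" "well_dimensioned I st" "solves_own I \<sigma> st"
  shows "well_dimensioned I (fold (process_vector I \<sigma>) bs st) \<and>
    solves_own I \<sigma> (fold (process_vector I \<sigma>) bs st)"
  by (rule fold_invariant[where Q = "\<lambda>b. b \<in> carrier_vec (card (star_positions I \<sigma>))"])
    (use assms in \<open>auto intro: well_dimensioned_process solves_own_process_same\<close>)

lemma pass_outside:
  assumes "\<not> \<sigma> \<le> \<tau>" "well_dimensioned I st" "solves_own I \<sigma> st"
  shows "well_dimensioned I (fold (process_vector I \<tau>) bs st) \<and>
    solves_own I \<sigma> (fold (process_vector I \<tau>) bs st)"
  by (rule fold_invariant[where Q = "\<lambda>_. True"])
    (use assms in \<open>auto intro: well_dimensioned_process solves_own_process_outside\<close>)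

lemma passes_outside:
  assumes "\<And>\<tau>. \<tau> \<in> set \<tau>s \<Longrightarrow> \<not> \<sigma> \<le> \<tau>" "well_dimensioned I st" "solves_own I \<sigma> st"
  shows "well_dimensioned I (fold (\<lambda>\<tau>. fold (process_vector I \<tau>) (B \<tau>)) \<tau>s st) \<and>
    solves_own I \<sigma> (fold (\<lambda>\<tau>. fold (process_vector I \<tau>) (B \<tau>)) \<tau>s st)"
  by (rule fold_invariant[where Q = "\<lambda>\<tau>. \<not> \<sigma> \<le> \<tau>"])
    (use assms pass_outside in \<open>blast\<close>)+

lemma linear_extension_split:
  assumes "linear_extension \<sigma>s"
  obtains before after where "\<sigma>s = before @ \<sigma> # after" "\<sigma> \<notin> set after"
    "\<And>\<tau>. \<tau> \<in> set before \<Longrightarrow> \<not> \<sigma> \<le> \<tau>"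
proof -
  have "\<sigma> \<in> set \<sigma>s" using assms by (simp add: linear_extension_def)
  then obtain before after where split: "\<sigma>s = before @ \<sigma> # after" by (meson split_list)
  moreover have "\<sigma> \<notin> set after" using assms by (simp add: linear_extension_def split)
  moreover have "\<not> \<sigma> \<le> \<tau>" if \<tau>: "\<tau> \<in> set before" for \<tau>
  proof
    assume le: "\<sigma> \<le> \<tau>"
    obtain i where i: "i < length before" "before ! i = \<tau>" using \<tau> by (auto simp: in_set_conv_nth)
    have "\<sigma>s ! length before \<le> \<sigma>s ! i" using i le by (simp add: split nth_append)
    moreover have "length before < length \<sigma>s" "i < length \<sigma>s" using i by (auto simp: split)
    ultimately have "length before \<le> i" using assms unfolding linear_extension_def by blast
    then show False using i by simp
  qed
  ultimately show thesis by (rule that)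
qed

lemma solves_own_run_step:
  assumes "linear_extension \<sigma>s" and "set (B \<sigma>) \<subseteq> carrier_vec (card (star_positions I \<sigma>))"
  shows "well_dimensioned I (run_step I \<sigma>s B)" "solves_own I \<sigma> (run_step I \<sigma>s B)"
proof -
  obtain before after where split: "\<sigma>s = before @ \<sigma> # after" and after: "\<sigma> \<notin> set after"
    and before: "\<And>\<tau>. \<tau> \<in> set before \<Longrightarrow> \<not> \<sigma> \<le> \<tau>"
    using linear_extension_split[OF assms(1)] by metis
  let ?pass = "\<lambda>\<tau>. fold (process_vector I \<tau>) (B \<tau>)"
  \<comment> \<open>the algorithm runs through the linear extension backwards\<close>
  define st where "st = fold ?pass (rev after) ([], 0\<^sub>m 0 (length I))"
  have "well_dimensioned I st \<and> \<sigma> \<notin> set (fst st)"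
    unfolding st_def by (rule passes_no_label) (use after in \<open>auto simp: well_dimensioned_def\<close>)
  then have "well_dimensioned I (?pass \<sigma> st) \<and> solves_own I \<sigma> (?pass \<sigma> st)"
    using assms(2) by (intro pass_same solves_own_no_label) auto
  then have "well_dimensioned I (fold ?pass (rev before) (?pass \<sigma> st)) \<and>
      solves_own I \<sigma> (fold ?pass (rev before) (?pass \<sigma> st))"
    using before by (intro passes_outside) auto
  then show "well_dimensioned I (run_step I \<sigma>s B)" "solves_own I \<sigma> (run_step I \<sigma>s B)"
    by (simp_all add: run_step_def split st_def)
qed

section \<open>Maximal vectors are in the image\<close>

lemma step_input_image:
  fixes \<eta> :: "'p::{finite,order} \<Rightarrow> 'k::field mat"
  assumes "step_input I \<eta>"
  shows "mat_image (\<eta> \<sigma>) \<subseteq> carrier_vec (card (star_positions I \<sigma>))"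
proof -
  have "dim_row (\<eta> \<sigma>) = card (star_positions I \<sigma>)"
    using assms
  proof cases
    case (injective I' A)
    then show ?thesis
      using component_carrier[of A I I' \<sigma>] by (simp add: represents_nat_trans_def)
  next
    case (initial F)
    then show ?thesis by (auto simp: nat_trans_def stalk_dim_inj_sheaf)
  qed
  then have "\<eta> \<sigma> *\<^sub>v v \<in> carrier_vec (card (star_positions I \<sigma>))" for v
    by (intro carrier_vecI) (simp only: dim_mult_mat_vec)
  then show ?thesis unfolding mat_image_def by (rule image_subsetI)
qed

theorem lemma28:
  fixes I\<^sub>k I\<^sub>k\<^sub>1 :: "'p::{finite,order} list"
    and \<eta>_prev :: "'p \<Rightarrow> 'k::field mat"
    and \<eta>\<^sub>k :: "'k mat"
  assumes "step_input I\<^sub>k \<eta>_prev"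
    and "step_output I\<^sub>k \<eta>_prev I\<^sub>k\<^sub>1 \<eta>\<^sub>k"
  shows "\<forall>\<sigma>. \<forall>s. maximal_vector (inj_sheaf I\<^sub>k\<^sub>1 :: ('p, 'k) sheaf) \<sigma> s \<longrightarrow>
           s \<in> mat_image (component I\<^sub>k I\<^sub>k\<^sub>1 \<eta>\<^sub>k \<sigma>)"
proof (intro allI impI)
  fix \<sigma> :: 'p and s :: "'k vec"
  assume max: "maximal_vector (inj_sheaf I\<^sub>k\<^sub>1 :: ('p, 'k) sheaf) \<sigma> s"
  let ?n = "card (star_positions I\<^sub>k \<sigma>)"
  obtain \<sigma>s B where ext: "linear_extension \<sigma>s"
    and basis: "is_basis_list ?n (vec_module.orthogonal_complement ?n (mat_image (\<eta>_prev \<sigma>))) (B \<sigma>)"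
    and run: "(I\<^sub>k\<^sub>1, \<eta>\<^sub>k) = run_step I\<^sub>k \<sigma>s B"
    using assms(2) by (auto simp: step_output_def stalk_dim_inj_sheaf)
  have "set (B \<sigma>) \<subseteq> carrier_vec ?n"
    using basis step_input_image[OF assms(1)] by (rule basis_list_orthogonal_complement_carrier)
  from solves_own_run_step[where B = B and \<sigma> = \<sigma>, OF ext this] have dims: "\<eta>\<^sub>k \<in> carrier_mat (length I\<^sub>k\<^sub>1) (length I\<^sub>k)"
    and solves: "solves_own I\<^sub>k \<sigma> (I\<^sub>k\<^sub>1, \<eta>\<^sub>k)"
    by (simp_all add: run[symmetric] well_dimensioned_def)
  from solves maximal_vector_supported_on_own[OF max]
  obtain v where "v \<in> carrier_vec ?n" "component I\<^sub>k I\<^sub>k\<^sub>1 \<eta>\<^sub>k \<sigma> *\<^sub>v v = s"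
    by (auto simp: solves_own_def)
  then show "s \<in> mat_image (component I\<^sub>k I\<^sub>k\<^sub>1 \<eta>\<^sub>k \<sigma>)"
    using component_carrier[OF dims, of \<sigma>] by (auto simp: mat_image_def)
qed

end
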